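(* Let $R$ be a division ring with $\mathrm{Char}(R)=0$ and let $\Gamma'(R)$ be the unity product graph associated with $R$. Then the following hold: (1) $\chi(\Gamma'(R))=2$; (2) $\omega(\Gamma'(R))=2$.
   Context: $\mathrm{Char}$ denotes the characteristic. For a ring $R$ with unity $e$, let $U(R)$ denote the set of units of $R$. The unity product graph $\Gamma'(R)$ is the simple graph with vertex set $U(R)$ in which two distinct vertices $r_i,r_j$ are adjacent if and only if $r_i\cdot r_j=e$. $\chi(\Gamma)$ is the chromatic number (the smallest $k$ such that $\Gamma$ has a proper vertex $k$-colouring) and $\omega(\Gamma)$ is the clique number (the greatest $n$ such that the complete graph $K_n$ is a subgraph of $\Gamma$). *)

theory Defs
  imports "HOL-Library.Extended_Nat" "Graph_Theory.Graph_Theory"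
begin

text \<open>
  As in Graph\_Theory, undirected graphs are symmetric digraphs: an edge is a pair of opposite
  arcs. The locale \<^locale>\<open>graph\<close> is not required of the graphs below, because it includes
  finiteness.
\<close>

definition proper_colouring :: "('a, 'b) pre_digraph \<Rightarrow> nat \<Rightarrow> ('a \<Rightarrow> nat) \<Rightarrow> bool" where
  "proper_colouring G k c \<longleftrightarrow>
     (\<forall>v \<in> verts G. c v < k) \<and> (\<forall>u v. u \<rightarrow>\<^bsub>G\<^esub> v \<longrightarrow> c u \<noteq> c v)"

text \<open>
  The values are in \<^typ>\<open>enat\<close> because the vertex set may be infinite: the chromatic number is
  \<open>\<infinity>\<close> if there is no finite proper colouring, and the clique number is \<open>\<infinity>\<close> if there are
  arbitrarily large finite cliques.
\<close>

definition chromatic_number :: "('a, 'b) pre_digraph \<Rightarrow> enat" where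
  "chromatic_number G = Inf (enat ` {k. \<exists>c. proper_colouring G k c})"

definition clique_number :: "('a, 'b) pre_digraph \<Rightarrow> enat" where
  "clique_number G = Sup (enat ` {n. \<exists>H. subgraph H G \<and> K\<^bsub>n\<^esub> H})"

text \<open>
  The library's \<open>is_unit\<close> is available for commutative rings only.
\<close>

definition ring_units :: "'a::ring_1 set" where
  "ring_units = {x. \<exists>y. x * y = 1 \<and> y * x = 1}"

definition unity_product_graph :: "'a::ring_1 itself \<Rightarrow> 'a pair_pre_digraph" where
  "unity_product_graph R =
     \<lparr>pverts = ring_units,
      parcs = {(r, s). r \<in> ring_units \<and> s \<in> ring_units \<and> r \<noteq> s \<and> r * s = 1}\<rparr>"

lemma ring_units_mult_eq_1_commute:
  fixes r s :: "'a::ring_1"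
  assumes "r \<in> ring_units" "r * s = 1"
  shows "s * r = 1"
proof -
  obtain y where y: "r * y = 1" "y * r = 1"
    using assms(1) by (auto simp: ring_units_def)
  have "s = (y * r) * s" by (simp add: y)
  also have "\<dots> = y" by (simp add: mult.assoc assms(2))
  finally show ?thesis using y by simp
qed

lemma unity_product_graph_simple: "pair_bidirected_digraph (unity_product_graph TYPE('a::ring_1))"
  by unfold_locales
    (auto simp: unity_product_graph_def symmetric_def intro!: symI dest: ring_units_mult_eq_1_commute)

lemma chromatic_number_eq_enat_iff:
  "chromatic_number G = enat k \<longleftrightarrow>
     (\<exists>c. proper_colouring G k c) \<and> (\<forall>j c. proper_colouring G j c \<longrightarrow> k \<le> j)"
proof -
  let ?S = "{k. \<exists>c. proper_colouring G k c}"
  show ?thesis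
  proof
    assume eq: "chromatic_number G = enat k"
    then have "enat ` ?S \<noteq> {}"
      unfolding chromatic_number_def Inf_enat_def by (metis enat.distinct(2))
    then obtain x where "x \<in> enat ` ?S" by blast
    then have "(LEAST x. x \<in> enat ` ?S) \<in> enat ` ?S" by (rule LeastI)
    then have "enat k \<in> enat ` ?S"
      using eq \<open>enat ` ?S \<noteq> {}\<close> unfolding chromatic_number_def Inf_enat_def by metis
    moreover have "enat k \<le> enat j" if "j \<in> ?S" for j
      using that unfolding eq[symmetric] chromatic_number_def by (intro Inf_lower) auto
    ultimately show "(\<exists>c. proper_colouring G k c) \<and> (\<forall>j c. proper_colouring G j c \<longrightarrow> k \<le> j)"
      using eq by auto
  next
    assume "(\<exists>c. proper_colouring G k c) \<and> (\<forall>j c. proper_colouring G j c \<longrightarrow> k \<le> j)"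
    then show "chromatic_number G = enat k"
      unfolding chromatic_number_def by (intro antisym Inf_lower Inf_greatest) auto
  qed
qed

lemma clique_number_eq_enat_iff:
  assumes "wf_digraph G"
  shows "clique_number G = enat n \<longleftrightarrow>
     (\<exists>H. subgraph H G \<and> K\<^bsub>n\<^esub> H) \<and> (\<forall>m H. subgraph H G \<and> K\<^bsub>m\<^esub> H \<longrightarrow> m \<le> n)"
  (is "_ \<longleftrightarrow> ?R")
proof
  show "clique_number G = enat n" if ?R
    using that unfolding clique_number_def by (intro antisym Sup_upper Sup_least) auto
next
  let ?S = "{m. \<exists>H. subgraph H G \<and> K\<^bsub>m\<^esub> H}"
  assume eq: "clique_number G = enat n"
  define H0 where "H0 = G\<lparr>verts := {}, arcs := {}\<rparr>"
  have "graph H0"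
    by unfold_locales (auto simp: H0_def symmetric_def arcs_ends_def intro: symI)
  then have "K\<^bsub>0\<^esub> H0"
    by (auto simp: complete_digraph_def H0_def arcs_ends_def)
  moreover have "subgraph H0 G"
    using assms \<open>graph H0\<close>
    by (auto simp: subgraph_def compatible_def H0_def graph_def digraph_def fin_digraph_def)
  ultimately have "enat ` ?S \<noteq> {}" by blast
  moreover from this eq have "finite (enat ` ?S)" "Max (enat ` ?S) = enat n"
    unfolding clique_number_def Sup_enat_def by (metis enat.distinct(1))+
  ultimately have "enat n \<in> enat ` ?S"
    using Max_in[of "enat ` ?S"] by simp
  moreover have "enat m \<le> enat n" if "m \<in> ?S" for m
    using that unfolding eq[symmetric] clique_number_def by (intro Sup_upper) auto
  ultimately show ?R by auto
qed

end

theory Submission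
  imports Defs
begin

text \<open>
  Two-sided inverses are unique, so every unit has at most one neighbour, and the unity product
  graph of any ring is a disjoint union of isolated vertices and single edges. Selecting one end of
  every edge therefore gives a proper 2-colouring
  (\<open>unity_product_graph_2_colouring\<close>). Conversely, a single edge is a clique of size 2. As a clique
  is never larger than the number of colours in a proper colouring (\<open>clique_le_colours\<close>), one
  2-colouring and one edge determine both numbers. In a division ring of characteristic 0, the
  units \<open>2\<close> and \<open>1/2\<close> are the ends of an edge: they differ because \<open>2 \<cdot> 2 - 1 = 3 \<noteq> 0\<close>.
\<close>

text \<open>
  Distinct vertices of a clique are adjacent, so a proper colouring is injective on the clique.
  The graph itself may be infinite.
\<close>

lemma clique_le_colours:
  assumes H: "subgraph H G" "K\<^bsub>n\<^esub> H" and c: "proper_colouring G k c"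
  shows "n \<le> k"
proof -
  have adj: "u \<rightarrow>\<^bsub>G\<^esub> v" if "u \<in> verts H" "v \<in> verts H" "u \<noteq> v" for u v
  proof -
    have "u \<rightarrow>\<^bsub>H\<^esub> v"
      using H(2) that by (auto simp: complete_digraph_def)
    then show ?thesis
      using H(1) by (rule pre_digraph.adj_mono)
  qed
  have "inj_on c (verts H)"
    using adj c by (metis inj_onI proper_colouring_def)
  moreover have "c ` verts H \<subseteq> {..<k}"
    using H(1) c by (auto simp: subgraph_def proper_colouring_def)
  ultimately have "card (verts H) \<le> card {..<k}"
    by (intro card_inj_on_le) auto
  then show ?thesis
    using H(2) by (simp add: complete_digraph_def)
qed

lemma edge_is_2_clique:
  fixes G :: "'a pair_pre_digraph"
  assumes G: "pair_bidirected_digraph G" and uv: "(u, v) \<in> parcs G"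
  shows "\<exists>H. subgraph H (with_proj G) \<and> K\<^bsub>2\<^esub> H"
proof -
  interpret pair_bidirected_digraph G by (rule G)
  have vu: "(v, u) \<in> parcs G"
    using uv arcs_symmetric by blast
  have ne: "u \<noteq> v"
    using uv no_loops' by blast
  have verts: "u \<in> pverts G" "v \<in> pverts G"
    using uv by (auto dest: in_arcsD1 in_arcsD2)
  define H :: "'a pair_pre_digraph" where "H = \<lparr>pverts = {u, v}, parcs = {(u, v), (v, u)}\<rparr>"
  interpret H: pair_graph H
    by unfold_locales (auto simp: H_def ne ne[symmetric] symmetric_def intro!: symI)
  have "K\<^bsub>2\<^esub> (with_proj H)"
    unfolding complete_digraph_def
    using H.graph_axioms ne by (auto simp: H_def arcs_ends_def arc_to_ends_def)
  moreover have "subgraph (with_proj H) (with_proj G)"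
    using uv vu verts wf_digraph H.wf_digraph
    by (auto simp: subgraph_def compatible_def H_def)
  ultimately show ?thesis by blast
qed

text \<open>
  A unit \<open>x\<close> and its inverse form the set \<open>E x\<close> below, which has one element if \<open>x\<close> is its own
  inverse and is otherwise the set of ends of an edge. One element of each such set gets colour 0,
  and the other one, if any, gets colour 1.
\<close>

lemma unity_product_graph_2_colouring:
  "\<exists>c. proper_colouring (with_proj (unity_product_graph TYPE('a::ring_1))) 2 c"
proof -
  define E where "E = (\<lambda>x::'a. insert x {y. x * y = 1 \<and> y * x = 1})"
  \<comment> \<open>The choice depends on the set \<open>E x\<close> alone, so the two ends of an edge choose the same vertex.\<close>
  define c where "c = (\<lambda>x::'a. if x = (SOME y. y \<in> E x) then 0 else 1 :: nat)"
  have "c r \<noteq> c s" if rs: "r \<in> ring_units" "r \<noteq> s" "r * s = 1" for r s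
  proof -
    have sr: "s * r = 1"
      using rs by (simp add: ring_units_mult_eq_1_commute)
    have "y = s" if "r * y = 1" for y
      using that sr mult.assoc[of s r y] by simp
    then have Er: "E r = {r, s}"
      using rs sr unfolding E_def by blast
    have "y = r" if "s * y = 1" for y
      using that rs(3) mult.assoc[of r s y] by simp
    then have Es: "E s = {r, s}"
      using rs sr unfolding E_def by blast
    have "(SOME y. y \<in> {r, s}) \<in> {r, s}"
      by (rule someI[of _ r]) simp
    then show ?thesis
      using rs(2) by (auto simp: c_def Er Es)
  qed
  moreover have "c x < 2" for x
    by (simp add: c_def)
  ultimately have "proper_colouring (with_proj (unity_product_graph TYPE('a))) 2 c"
    by (auto simp: proper_colouring_def unity_product_graph_def arcs_ends_def arc_to_ends_def)
  then show ?thesis by blast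
qed

theorem theorem5p6:
  assumes "CHAR('a::division_ring) = 0"
  shows "chromatic_number (unity_product_graph TYPE('a)) = 2 \<and>
    clique_number (unity_product_graph TYPE('a)) = 2"
proof -
  let ?G = "unity_product_graph TYPE('a)"
  interpret pair_bidirected_digraph ?G
    by (rule unity_product_graph_simple)
  \<comment> \<open>\<open>2 \<noteq> 0\<close> makes 2 a unit, and \<open>3 \<noteq> 0\<close> separates it from its inverse.\<close>
  have two: "(2::'a) \<noteq> 0" and three: "(3::'a) \<noteq> 0"
    using assms of_nat_eq_0_iff_char_dvd[of 2, where 'a='a]
      of_nat_eq_0_iff_char_dvd[of 3, where 'a='a] by auto
  have "(2::'a) \<noteq> inverse 2"
  proof
    assume "(2::'a) = inverse 2"
    then have "(2::'a) * 2 = 1"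
      using two by (metis right_inverse)
    then have "(3::'a) + 1 = 0 + 1"
      by simp
    then show False
      using three by (simp only: add_right_cancel)
  qed
  moreover have "(2::'a) \<in> ring_units" "inverse (2::'a) \<in> ring_units"
    using left_inverse[OF two] right_inverse[OF two] unfolding ring_units_def by blast+
  ultimately have "(2, inverse 2) \<in> parcs ?G"
    using two by (simp add: unity_product_graph_def)
  then obtain H where H: "subgraph H (with_proj ?G)" "K\<^bsub>2\<^esub> H"
    using edge_is_2_clique[OF unity_product_graph_simple] by blast
  obtain c where c: "proper_colouring (with_proj ?G) 2 c"
    using unity_product_graph_2_colouring by blast
  have "chromatic_number (with_proj ?G) = enat 2"
    unfolding chromatic_number_eq_enat_iff using c clique_le_colours[OF H] by blast
  moreover have "clique_number (with_proj ?G) = enat 2"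
    unfolding clique_number_eq_enat_iff[OF wf_digraph] using H clique_le_colours[OF _ _ c] by blast
  ultimately show ?thesis
    by (simp add: numeral_eq_enat)
qed

end
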